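(* Let $G=(V,E)$ be a finite connected graph and let $\Psi\le\mathrm{Aut}(G)$ be a group of automorphisms. Then $G$ is lower conformally rigid if and only if there exists a spectral embedding of $G$ on $\mathcal{E}_{\lambda_2}$ that is orbit-isometric with respect to $\Psi$. Likewise, $G$ is upper conformally rigid if and only if there exists a spectral embedding of $G$ on $\mathcal{E}_{\lambda_n}$ that is orbit-isometric with respect to $\Psi$.
   Context: $G=(V,E)$ is a finite, connected, simple undirected graph with $n=|V|\ge 2$ vertices. For edge weights $w:E\to\mathbb{R}$, $w\ge 0$, the weighted Laplacian $L(w)$ is the symmetric matrix with quadratic form $\langle\varphi,L(w)\varphi\rangle=\sum_{uv\in E}w_{uv}(\varphi(u)-\varphi(v))^2$ for $\varphi\in\mathbb{R}^V$, and its eigenvalues are $0=\lambda_1(w)\le\lambda_2(w)\le\cdots\le\lambda_n(w)$. Write $\mathbf{1}$ for the all-ones vector, $L=L(\mathbf{1})$, $\lambda_k=\lambda_k(\mathbf{1})$, and $\mathcal{E}_\lambda=\{\varphi\in\mathbb{R}^V: L\varphi=\lambda\varphi\}$. $G$ is lower conformally rigid if $\lambda_2(w)\le\lambda_2$ for all $w\ge 0$ with $\sum_{uv\in E}w_{uv}=|E|$; $G$ is upper conformally rigid if $\lambda_n(w)\ge\lambda_n$ for all $w\ge 0$ with $\sum_{uv\in E}w_{uv}=|E|$. For a Laplacian eigenvalue $\lambda>0$ and $\varphi_1,\dots,\varphi_r\in\mathcal{E}_\lambda$ (any finite $r$), let $P=(\varphi_1\ \cdots\ \varphi_r)\in\mathbb{R}^{n\times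 r}$. The associated spectral embedding of $G$ on $\mathcal{E}_\lambda$ is the family $\mathcal{P}=\{p_v\}_{v\in V}\subseteq\mathbb{R}^r$ where $p_v^T$ is the $v$-th row of $P$ (the map $v\mapsto p_v$ need not be injective). Let $\mathcal{O}_1,\dots,\mathcal{O}_s$ be the orbits of $\Psi$ on the edge set $E$. The embedding $\mathcal{P}$ is orbit-isometric with respect to $\Psi$ if there is a constant $c>0$ such that $\frac{1}{|\mathcal{O}_i|}\sum_{uv\in\mathcal{O}_i}\|p_u-p_v\|^2=c$ for all $1\le i\le s$. *)

theory Defs
  imports "HOL-Analysis.Analysis" "HOL-Algebra.Group_Action" "HOL-Library.Multiset"
begin

text \<open>
  The vertex set is the whole (finite) type \<open>'v\<close>, and an edge is the
  two-element set of its end points.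
\<close>

definition simple_graph :: "'v set set \<Rightarrow> bool" where
  "simple_graph E \<longleftrightarrow> (\<forall>e\<in>E. card e = 2)"

definition connected_graph :: "'v set set \<Rightarrow> bool" where
  "connected_graph E \<longleftrightarrow> (\<forall>u v. (u, v) \<in> {(x, y). {x, y} \<in> E}\<^sup>*)"

text \<open>
  The value \<open>f u v\<close> at an edge \<open>uv\<close>; meaningful for symmetric \<open>f\<close>, see
  \<open>on_edge_eq\<close> below.
\<close>

definition on_edge :: "('v \<Rightarrow> 'v \<Rightarrow> real) \<Rightarrow> 'v set \<Rightarrow> real" where
  "on_edge f e = (THE x. \<exists>u v. e = {u, v} \<and> x = f u v)"

lemma on_edge_eq:
  assumes "\<And>x y. f x y = f y x"
  shows "on_edge f {u, v} = f u v"
  unfolding on_edge_def using assms by (auto simp: doubleton_eq_iff intro!: the_equality)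

text \<open>Weights are only evaluated on \<open>E\<close>.\<close>

definition laplacian :: "'v::finite set set \<Rightarrow> ('v set \<Rightarrow> real) \<Rightarrow> real ^ 'v ^ 'v" where
  "laplacian E w = (\<chi> u v. if u = v then (\<Sum>e | e \<in> E \<and> u \<in> e. w e)
                           else if {u, v} \<in> E then - w {u, v} else 0)"

lemma transpose_laplacian: "transpose (laplacian E w) = laplacian E w"
  by (simp add: transpose_def laplacian_def vec_eq_iff insert_commute)

lemma laplacian_quadratic_form:
  fixes E :: "'v::finite set set"
  assumes "simple_graph E"
  shows "\<phi> \<bullet> (laplacian E w *v \<phi>) = (\<Sum>e\<in>E. w e * on_edge (\<lambda>u v. (\<phi> $ u - \<phi> $ v)\<^sup>2) e)"
proof -
  have "laplacian E w $ u $ v = (\<Sum>e\<in>E. w e *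
      (if u \<in> e \<and> v \<in> e then if u = v then 1 else - 1 else 0))" for u v
  proof (cases "u = v")
    case True
    then show ?thesis
      by (simp add: laplacian_def sum.inter_filter if_distrib[of "(*) _"] cong: if_cong)
  next
    case False
    have "u \<in> e \<and> v \<in> e \<longleftrightarrow> e = {u, v}" if "e \<in> E" for e
      using that False assms by (auto simp: simple_graph_def card_2_iff)
    then have "(\<Sum>e\<in>E. w e * (if u \<in> e \<and> v \<in> e then if u = v then 1 else - 1 else 0)) =
        (\<Sum>e\<in>E. if e = {u, v} then - w {u, v} else 0)"
      using False by (intro sum.cong) auto
    then show ?thesis
      using False by (simp add: laplacian_def)
  qed
  then have "\<phi> \<bullet> (laplacian E w *v \<phi>) = (\<Sum>u\<in>UNIV. \<Sum>v\<in>UNIV. \<Sum>e\<in>E. w e *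
      (\<phi> $ u * \<phi> $ v * (if u \<in> e \<and> v \<in> e then if u = v then 1 else - 1 else 0)))"
    by (simp add: inner_vec_def matrix_vector_mult_def sum_distrib_left sum_distrib_right mult_ac)
  also have "\<dots> = (\<Sum>e\<in>E. w e * (\<Sum>u\<in>UNIV. \<Sum>v\<in>UNIV.
      \<phi> $ u * \<phi> $ v * (if u \<in> e \<and> v \<in> e then if u = v then 1 else - 1 else 0)))"
  proof -
    have "(\<Sum>u\<in>UNIV. \<Sum>v\<in>UNIV. \<Sum>e\<in>E. f u v e) = (\<Sum>e\<in>E. \<Sum>u\<in>UNIV. \<Sum>v\<in>UNIV. f u v e)"
      for f :: "'v \<Rightarrow> 'v \<Rightarrow> 'v set \<Rightarrow> real"
      by (simp only: sum.swap[where A = UNIV and B = E])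
    then show ?thesis by (simp add: sum_distrib_left)
  qed
  also have "\<dots> = (\<Sum>e\<in>E. w e * on_edge (\<lambda>u v. (\<phi> $ u - \<phi> $ v)\<^sup>2) e)"
  proof (rule sum.cong)
    fix e assume "e \<in> E"
    then obtain a b where e: "e = {a, b}" "a \<noteq> b"
      using assms by (auto simp: simple_graph_def card_2_iff)
    have "(\<Sum>u\<in>UNIV. \<Sum>v\<in>UNIV.
        \<phi> $ u * \<phi> $ v * (if u \<in> e \<and> v \<in> e then if u = v then 1 else - 1 else 0)) =
        (\<Sum>u\<in>{a, b}. \<Sum>v\<in>{a, b}. \<phi> $ u * \<phi> $ v * (if u = v then 1 else - 1))"
      using e by (intro sum.mono_neutral_cong_right) (auto intro!: sum.mono_neutral_cong_right)
    also have "\<dots> = (\<phi> $ a - \<phi> $ b)\<^sup>2"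
      using e by (simp add: power2_eq_square algebra_simps)
    also have "\<dots> = on_edge (\<lambda>u v. (\<phi> $ u - \<phi> $ v)\<^sup>2) e"
      using e by (simp add: on_edge_eq power2_commute)
    finally show "w e * (\<Sum>u\<in>UNIV. \<Sum>v\<in>UNIV.
        \<phi> $ u * \<phi> $ v * (if u \<in> e \<and> v \<in> e then if u = v then 1 else - 1 else 0)) =
        w e * on_edge (\<lambda>u v. (\<phi> $ u - \<phi> $ v)\<^sup>2) e" by simp
  qed simp
  finally show ?thesis .
qed

lemma laplacian_unique:
  fixes A :: "real ^ 'v::finite ^ 'v"
  assumes E: "simple_graph E" and sym: "transpose A = A"
    and qf: "\<And>\<phi>. \<phi> \<bullet> (A *v \<phi>) = (\<Sum>e\<in>E. w e * on_edge (\<lambda>u v. (\<phi> $ u - \<phi> $ v)\<^sup>2) e)"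
  shows "A = laplacian E w"
proof -
  define B where "B = A - laplacian E w"
  have B0: "\<phi> \<bullet> (B *v \<phi>) = 0" for \<phi>
    by (simp add: B_def qf laplacian_quadratic_form[OF E] matrix_vector_mult_diff_rdistrib inner_diff_right)
  have Bs: "transpose B = B"
    using sym transpose_laplacian[of E w] by (simp add: B_def transpose_def vec_eq_iff)
  have sw: "x \<bullet> (B *v y) = y \<bullet> (B *v x)" for x y
  proof -
    have "x \<bullet> (B *v y) = (transpose B *v x) \<bullet> y"
      by (simp only: dot_lmul_matrix transpose_matrix_vector)
    then show ?thesis by (simp only: Bs inner_commute)
  qed
  have "x \<bullet> (B *v y) = 0" for x y
    using B0[of "x + y"] B0[of x] B0[of y] sw[of x y]
    by (simp add: matrix_vector_right_distrib inner_add_left inner_add_right)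
  then have "B *v y = 0" for y
    using inner_eq_zero_iff[of "B *v y"] by simp
  then have "B = 0"
    unfolding matrix_eq by simp
  then show ?thesis by (simp add: B_def)
qed

definition eigenspace :: "real ^ 'n ^ 'n \<Rightarrow> real \<Rightarrow> (real ^ 'n) set" where
  "eigenspace A \<mu> = {\<phi>. A *v \<phi> = \<mu> *\<^sub>R \<phi>}"

definition is_eigenvalue :: "real ^ 'n ^ 'n \<Rightarrow> real \<Rightarrow> bool" where
  "is_eigenvalue A \<mu> \<longleftrightarrow> (\<exists>\<phi>. \<phi> \<noteq> 0 \<and> \<phi> \<in> eigenspace A \<mu>)"

text \<open>
  Eigenvalues are listed with geometric multiplicity. It is only used for symmetric
  matrices, where this agrees with algebraic multiplicity and yields \<open>CARD('n)\<close> entries.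
\<close>

definition eigenvalue_mset :: "real ^ 'n ^ 'n \<Rightarrow> real multiset" where
  "eigenvalue_mset A =
     (\<Sum>\<mu> | is_eigenvalue A \<mu>. replicate_mset (dim (eigenspace A \<mu>)) \<mu>)"

text \<open>\<open>lap_eigenvalue E w k\<close> is \<open>\<lambda>\<^sub>k(w)\<close>, numbered from \<open>k = 1\<close>.\<close>

definition lap_eigenvalue :: "'v::finite set set \<Rightarrow> ('v set \<Rightarrow> real) \<Rightarrow> nat \<Rightarrow> real" where
  "lap_eigenvalue E w k = sorted_list_of_multiset (eigenvalue_mset (laplacian E w)) ! (k - 1)"

definition normalized_weight :: "'v set set \<Rightarrow> ('v set \<Rightarrow> real) \<Rightarrow> bool" where
  "normalized_weight E w \<longleftrightarrow> (\<forall>e\<in>E. 0 \<le> w e) \<and> (\<Sum>e\<in>E. w e) = real (card E)"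

definition lower_conformally_rigid :: "'v::finite set set \<Rightarrow> bool" where
  "lower_conformally_rigid E \<longleftrightarrow>
     (\<forall>w. normalized_weight E w \<longrightarrow> lap_eigenvalue E w 2 \<le> lap_eigenvalue E (\<lambda>_. 1) 2)"

definition upper_conformally_rigid :: "'v::finite set set \<Rightarrow> bool" where
  "upper_conformally_rigid E \<longleftrightarrow>
     (\<forall>w. normalized_weight E w \<longrightarrow>
        lap_eigenvalue E w CARD('v) \<ge> lap_eigenvalue E (\<lambda>_. 1) CARD('v))"

text \<open>
  Since the dimension \<open>r\<close> is quantified over, a point of \<open>\<real>\<^sup>r\<close> is a function on \<open>nat\<close> of
  which only the values at \<open>i < r\<close> matter: \<open>p v i\<close> is the entry of \<open>P\<close> in row \<open>v\<close> and
  column \<open>i\<close>, and \<open>\<phi> i\<close> is column \<open>i\<close>.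
\<close>

definition spectral_embedding ::
    "'v::finite set set \<Rightarrow> real \<Rightarrow> nat \<Rightarrow> ('v \<Rightarrow> nat \<Rightarrow> real) \<Rightarrow> bool" where
  "spectral_embedding E \<mu> r p \<longleftrightarrow>
     is_eigenvalue (laplacian E (\<lambda>_. 1)) \<mu> \<and> 0 < \<mu> \<and>
     (\<exists>\<phi>. \<forall>i<r. \<phi> i \<in> eigenspace (laplacian E (\<lambda>_. 1)) \<mu> \<and> (\<forall>v. p v i = \<phi> i $ v))"

definition aut_group :: "'v set set \<Rightarrow> ('v \<Rightarrow> 'v) monoid" where
  "aut_group E =
     (BijGroup UNIV)\<lparr>carrier := {g \<in> Bij UNIV. \<forall>u v. {g u, g v} \<in> E \<longleftrightarrow> {u, v} \<in> E}\<rparr>"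

lemma group_aut_group: "group (aut_group E)"
  unfolding aut_group_def
proof (rule group.subgroup_imp_group[OF group_BijGroup], rule group.subgroupI[OF group_BijGroup])
  let ?A = "{g \<in> Bij UNIV. \<forall>u v. {g u, g v} \<in> E \<longleftrightarrow> {u, v} \<in> E}"
  show "?A \<subseteq> carrier (BijGroup UNIV)" by (auto simp: BijGroup_def)
  have "id \<in> ?A" by (simp add: Bij_def)
  then show "?A \<noteq> {}" by blast
  show "inv\<^bsub>BijGroup UNIV\<^esub> g \<in> ?A" if "g \<in> ?A" for g
  proof -
    have g: "g \<in> Bij UNIV" "bij g" and E: "\<And>u v. {g u, g v} \<in> E \<longleftrightarrow> {u, v} \<in> E"
      using that by (auto simp: Bij_def)
    have "inv\<^bsub>BijGroup UNIV\<^esub> g = inv_into UNIV g"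
      using g(1) by (simp add: inv_BijGroup restrict_UNIV)
    moreover have "{inv_into UNIV g u, inv_into UNIV g v} \<in> E \<longleftrightarrow> {u, v} \<in> E" for u v
      using E[of "inv_into UNIV g u" "inv_into UNIV g v"] g(2)
      by (simp add: bij_is_surj surj_f_inv_f)
    ultimately show ?thesis using g by (simp add: Bij_def bij_imp_bij_inv)
  qed
  show "g \<otimes>\<^bsub>BijGroup UNIV\<^esub> h \<in> ?A" if "g \<in> ?A" "h \<in> ?A" for g h
  proof -
    have "g \<otimes>\<^bsub>BijGroup UNIV\<^esub> h = compose UNIV g h"
      using that by (simp add: BijGroup_def)
    moreover have "compose UNIV g h \<in> Bij UNIV"
      using that by (simp add: compose_Bij)
    ultimately show ?thesis using that by (simp add: compose_def)
  qed
qed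

definition edge_orbits :: "'v set set \<Rightarrow> ('v \<Rightarrow> 'v) set \<Rightarrow> 'v set set set" where
  "edge_orbits E \<Psi> = orbits ((aut_group E)\<lparr>carrier := \<Psi>\<rparr>) E (\<lambda>g e. g ` e)"

definition orbit_isometric ::
    "'v set set \<Rightarrow> ('v \<Rightarrow> 'v) set \<Rightarrow> nat \<Rightarrow> ('v \<Rightarrow> nat \<Rightarrow> real) \<Rightarrow> bool" where
  "orbit_isometric E \<Psi> r p \<longleftrightarrow>
     (\<exists>c>0. \<forall>Orb \<in> edge_orbits E \<Psi>.
        (1 / real (card Orb)) *
          (\<Sum>e\<in>Orb. on_edge (\<lambda>u v. (L2_set (\<lambda>i. p u i - p v i) {..<r})\<^sup>2) e) = c)"

end

theory Submission
  imports Defs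
begin

text \<open>
  On the orthogonal complement of the all-ones vector, \<open>\<lambda>\<^sub>2(w)\<close> is the minimum and \<open>\<lambda>\<^sub>n(w)\<close> the
  maximum of the Rayleigh quotient of \<open>L(w)\<close>. Both cases are handled together with a sign \<open>s\<close>
  (\<open>extremal_eigenvalue\<close>). The spectral theorem identifies these two extrema with entries of the
  sorted list of eigenvalues (\<open>sorted_eigenfamily_exists\<close>, \<open>sorted_eigenvalues_eq\<close>).

  The energy \<open>\<phi> \<bullet> L(w) \<phi>\<close> is the pairing of the weight \<open>w\<close> with the vector of squared differences of
  \<open>\<phi>\<close> along the edges. Rigidity says that the unit weight optimizes the extremal eigenvalue, which
  is a concave or convex function of \<open>w\<close>, over the simplex of normalized weights. The eigenspace
  supplies its super- or subgradients at the unit weight, namely the convex combinations of squared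
  difference vectors of unit eigenvectors, and optimality at this interior point of the simplex
  means that one of them is a multiple of the all-ones vector. Up to scaling, such a combination is
  the same thing as a spectral embedding in which all edges have equal length.

  If no such combination exists, a hyperplane separates the constant vector from the compact convex
  hull of the squared difference vectors and yields a direction in which a small change of weights
  improves the eigenvalue strictly (\<open>improving_perturbation\<close>, \<open>rigid_imp_edge_isometric\<close>).
  Conversely, an orbit-isometric embedding becomes an embedding with equal edge lengths once all
  translates of its columns under the group are included, since averaging over the group is averaging
  over orbits (\<open>group_average_eq_orbit_average\<close>); comparing energies then gives rigidity
  (\<open>averaged_isometric_imp_rigid\<close>).
\<close>

section \<open>Symmetric matrices and sorted eigenbases\<close>

lemma symmetric_matrix_inner:
  fixes A :: "real ^ 'n ^ 'n"
  assumes "transpose A = A"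
  shows "x \<bullet> (A *v y) = (A *v x) \<bullet> y"
  by (metis assms dot_lmul_matrix transpose_matrix_vector)

text \<open>
  The first-order condition for a minimum of the Rayleigh quotient: moving from a minimizer
  \<open>x\<close> along the residual \<open>y = A x - \<mu> x\<close> changes the form \<open>x \<bullet> A x - \<mu> (x \<bullet> x)\<close> by
  \<open>2 t (y \<bullet> y)\<close> to first order in \<open>t\<close>, so a small negative \<open>t\<close> would make it negative unless
  \<open>y = 0\<close>. Working on an invariant subspace keeps the residual inside it.
\<close>

lemma minimizer_is_eigenvector:
  fixes A :: "real ^ 'n ^ 'n"
  assumes A: "transpose A = A" and S: "subspace S" and inv: "\<And>x. x \<in> S \<Longrightarrow> A *v x \<in> S"
    and min: "\<And>y. y \<in> S \<Longrightarrow> \<mu> * (y \<bullet> y) \<le> y \<bullet> (A *v y)"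
    and x: "x \<in> S" "x \<bullet> (A *v x) = \<mu> * (x \<bullet> x)"
  shows "A *v x = \<mu> *\<^sub>R x"
proof -
  define y where "y = A *v x - \<mu> *\<^sub>R x"
  define a where "a = y \<bullet> (A *v y) - \<mu> * (y \<bullet> y)"
  have y: "y \<in> S"
    by (simp add: y_def S inv subspace_diff subspace_scale x)
  have xy: "x \<bullet> (A *v y) = (A *v x) \<bullet> y" "y \<bullet> (A *v x) = (A *v x) \<bullet> y"
    using symmetric_matrix_inner[OF A] by (auto simp: inner_commute)
  have key: "0 \<le> 2 * t * (y \<bullet> y) + t\<^sup>2 * a" for t
  proof -
    have "x + t *\<^sub>R y \<in> S"
      by (simp add: S subspace_add subspace_scale x y)
    from min[OF this] have "0 \<le> (x + t *\<^sub>R y) \<bullet> (A *v (x + t *\<^sub>R y))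
        - \<mu> * ((x + t *\<^sub>R y) \<bullet> (x + t *\<^sub>R y))" by simp
    also have "(x + t *\<^sub>R y) \<bullet> (A *v (x + t *\<^sub>R y)) =
        x \<bullet> (A *v x) + 2 * t * ((A *v x) \<bullet> y) + t\<^sup>2 * (y \<bullet> (A *v y))"
      by (simp add: matrix_vector_right_distrib matrix_vector_mult_scaleR inner_add_left
          inner_add_right xy power2_eq_square algebra_simps)
    also have "(x + t *\<^sub>R y) \<bullet> (x + t *\<^sub>R y) = x \<bullet> x + 2 * t * (x \<bullet> y) + t\<^sup>2 * (y \<bullet> y)"
      by (simp add: inner_add_left inner_add_right inner_commute[of y x] power2_eq_square
          algebra_simps)
    finally have "0 \<le> 2 * t * ((A *v x) \<bullet> y - \<mu> * (x \<bullet> y)) + t\<^sup>2 * a"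
      unfolding x(2) a_def by (simp add: algebra_simps)
    moreover have "(A *v x) \<bullet> y - \<mu> * (x \<bullet> y) = y \<bullet> y"
      by (simp add: y_def inner_diff_left)
    ultimately show ?thesis by simp
  qed
  have "y \<bullet> y = 0"
  proof (rule ccontr)
    assume "y \<bullet> y \<noteq> 0"
    then have p: "y \<bullet> y > 0" by simp
    \<comment> \<open>Small enough for the quadratic term to be dominated: \<open>\<bar>t a\<bar> \<le> y \<bullet> y\<close>.\<close>
    define t where "t = - (y \<bullet> y) / (\<bar>a\<bar> + 1)"
    have "- (t * a) \<le> \<bar>t\<bar> * \<bar>a\<bar>" by (metis abs_ge_minus_self abs_mult)
    also have "\<dots> \<le> y \<bullet> y"
      using p by (simp add: t_def field_simps)
    finally have "0 < 2 * (y \<bullet> y) + t * a" using p by linarith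
    moreover have "t < 0" using p by (simp add: t_def field_simps)
    ultimately have "t * (2 * (y \<bullet> y) + t * a) < 0" by (simp add: mult_neg_pos)
    with key[of t] show False by (simp add: power2_eq_square algebra_simps)
  qed
  then show ?thesis by (simp add: y_def)
qed

lemma minimal_eigenvector_exists:
  fixes A :: "real ^ 'n ^ 'n"
  assumes A: "transpose A = A" and S: "subspace S" and inv: "\<And>x. x \<in> S \<Longrightarrow> A *v x \<in> S"
    and "dim S > 0"
  obtains x \<mu> where "x \<in> S" "norm x = 1" "A *v x = \<mu> *\<^sub>R x"
    "\<And>y. y \<in> S \<Longrightarrow> \<mu> * (y \<bullet> y) \<le> y \<bullet> (A *v y)"
proof -
  let ?K = "S \<inter> sphere 0 1"
  obtain z where z: "z \<in> S" "z \<noteq> 0"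
    using \<open>dim S > 0\<close> by (metis dim_eq_0 neq0_conv subset_iff singletonI)
  then have "(1 / norm z) *\<^sub>R z \<in> ?K"
    by (simp add: S subspace_scale)
  moreover have "compact ?K"
    by (simp add: closed_Int_compact closed_subspace S)
  moreover have "continuous_on ?K (\<lambda>x. x \<bullet> (A *v x))"
    by (intro continuous_intros matrix_vector_mult_linear_continuous_on)
  ultimately obtain x where x: "x \<in> ?K" and
    min: "\<And>y. y \<in> ?K \<Longrightarrow> x \<bullet> (A *v x) \<le> y \<bullet> (A *v y)"
    using continuous_attains_inf[of ?K "\<lambda>x. x \<bullet> (A *v x)"] by blast
  define \<mu> where "\<mu> = x \<bullet> (A *v x)"
  have ge: "\<mu> * (y \<bullet> y) \<le> y \<bullet> (A *v y)" if "y \<in> S" for y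
  proof (cases "y = 0")
    case False
    have "(1 / norm y) *\<^sub>R y \<in> ?K"
      using that False by (simp add: S subspace_scale)
    from min[OF this] have "\<mu> \<le> (y \<bullet> (A *v y)) / (norm y)\<^sup>2"
      by (simp add: \<mu>_def matrix_vector_mult_scaleR power2_eq_square)
    then show ?thesis
      using False by (simp add: dot_square_norm field_simps)
  qed simp
  have "A *v x = \<mu> *\<^sub>R x"
    using x by (intro minimizer_is_eigenvector[OF A S inv ge])
      (auto simp: \<mu>_def dot_square_norm)
  with x ge that show ?thesis by auto
qed

text \<open>
  The indices start from 0 and the eigenvalues \<open>m\<close> are nondecreasing, so that when \<open>b\<close> is a basis of
  the whole space, \<open>m\<close> is literally the sorted list of eigenvalues.
\<close>

definition orthonormal_eigenfamily ::
    "real ^ 'n ^ 'n \<Rightarrow> (real ^ 'n) set \<Rightarrow> nat \<Rightarrow> (nat \<Rightarrow> real ^ 'n) \<Rightarrow> (nat \<Rightarrow> real) \<Rightarrow> bool" where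
  "orthonormal_eigenfamily A S k b m \<longleftrightarrow>
     (\<forall>i<k. b i \<in> S \<and> A *v b i = m i *\<^sub>R b i) \<and>
     (\<forall>i<k. \<forall>j<k. b i \<bullet> b j = (if i = j then 1 else 0)) \<and>
     (\<forall>i j. i \<le> j \<longrightarrow> j < k \<longrightarrow> m i \<le> m j)"

lemma orthonormal_eigenfamily_Cons:
  fixes A :: "real ^ 'n ^ 'n"
  assumes fam: "orthonormal_eigenfamily A T k b m"
    and x: "norm x = 1" "A *v x = \<mu> *\<^sub>R x" "x \<in> S"
    and T: "T \<subseteq> S" "\<And>y. y \<in> T \<Longrightarrow> x \<bullet> y = 0"
    and min: "\<And>y. y \<in> T \<Longrightarrow> \<mu> * (y \<bullet> y) \<le> y \<bullet> (A *v y)"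
  shows "orthonormal_eigenfamily A S (Suc k) (case_nat x b) (case_nat \<mu> m)"
proof -
  have b: "b i \<in> T" if "i < k" for i
    using fam that by (auto simp: orthonormal_eigenfamily_def)
  have bx: "x \<bullet> b i = 0" "b i \<bullet> x = 0" if "i < k" for i
    using T(2)[OF b[OF that]] by (simp_all add: inner_commute)
  have \<mu>: "\<mu> \<le> m i" if "i < k" for i
    using min[OF b[OF that]] fam that by (auto simp: orthonormal_eigenfamily_def)
  have "x \<bullet> x = 1" using x(1) by (simp add: dot_square_norm)
  then show ?thesis
    using fam x T(1) b bx \<mu>
    by (auto simp: orthonormal_eigenfamily_def less_Suc_eq_0_disj split: nat.splits)
qed

text \<open>
  The spectral theorem by repeated minimization: split off a minimizer of the Rayleigh quotient on
  \<open>S\<close> and continue in its orthogonal complement within \<open>S\<close>, which is again invariant because \<open>A\<close>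
  is symmetric. Each minimum is taken over a smaller space than the one before, which sorts the
  eigenvalues.
\<close>

lemma sorted_eigenfamily_exists:
  fixes A :: "real ^ 'n ^ 'n"
  assumes A: "transpose A = A" and "subspace S" and "\<And>x. x \<in> S \<Longrightarrow> A *v x \<in> S"
  shows "\<exists>b m. orthonormal_eigenfamily A S (dim S) b m"
  using assms(2,3)
proof (induction "dim S" arbitrary: S)
  case 0
  then show ?case by (simp add: orthonormal_eigenfamily_def flip: "0.hyps")
next
  case (Suc k)
  obtain x \<mu> where x: "x \<in> S" "norm x = 1" "A *v x = \<mu> *\<^sub>R x"
    and min: "\<And>y. y \<in> S \<Longrightarrow> \<mu> * (y \<bullet> y) \<le> y \<bullet> (A *v y)"
    using minimal_eigenvector_exists[OF A Suc.prems] Suc.hyps(2) by (metis zero_less_Suc)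
  define T where "T = {y \<in> S. x \<bullet> y = 0}"
  have sub: "subspace T"
    using Suc.prems(1) by (auto simp: T_def subspace_def inner_add_right)
  have "T = {y \<in> S. \<forall>z\<in>span {x}. orthogonal z y}"
    by (auto simp: T_def orthogonal_def span_singleton)
  then have "dim T + dim {x} = dim S"
    using dim_subspace_orthogonal_to_vectors[of "span {x}" S] Suc.prems(1) x(1)
    by (simp add: span_minimal)
  moreover have "dim {x} = 1"
    using x(2) dim_eq_card_independent[of "{x}"] by auto
  ultimately have kT: "k = dim T" using Suc.hyps(2) by simp
  have inv: "A *v y \<in> T" if "y \<in> T" for y
    using that Suc.prems(2) symmetric_matrix_inner[OF A, of x y] x(3) by (auto simp: T_def)
  obtain b m where "orthonormal_eigenfamily A T k b m"
    using Suc.hyps(1)[OF kT sub inv] unfolding kT[symmetric] by iprover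
  then have "orthonormal_eigenfamily A S (Suc k) (case_nat x b) (case_nat \<mu> m)"
  proof (rule orthonormal_eigenfamily_Cons[OF _ x(2,3,1)])
    show "T \<subseteq> S" "\<And>y. y \<in> T \<Longrightarrow> x \<bullet> y = 0" by (auto simp: T_def)
    show "\<mu> * (y \<bullet> y) \<le> y \<bullet> (A *v y)" if "y \<in> T" for y
      using min that by (simp add: T_def)
  qed
  then show ?case unfolding Suc.hyps(2)[symmetric] by blast
qed

lemma orthonormal_eigenfamily_independent:
  fixes A :: "real ^ 'n ^ 'n"
  assumes fam: "orthonormal_eigenfamily A S k b m" and I: "I \<subseteq> {..<k}"
  shows "inj_on b I" "independent (b ` I)"
proof -
  have ip: "b i \<bullet> b j = (if i = j then 1 else 0)" if "i \<in> I" "j \<in> I" for i j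
    using fam subsetD[OF I that(1)] subsetD[OF I that(2)]
    by (simp add: orthonormal_eigenfamily_def)
  show "inj_on b I"
    using ip by (auto simp: inj_on_def) (metis zero_neq_one)
  show "independent (b ` I)"
  proof (rule pairwise_orthogonal_independent)
    show "pairwise orthogonal (b ` I)"
      using ip by (auto simp: pairwise_def orthogonal_def)
    show "0 \<notin> b ` I"
      using ip by (metis imageE inner_zero_left zero_neq_one)
  qed
qed

lemma orthonormal_eigenfamily_expand:
  fixes A :: "real ^ 'n ^ 'n"
  assumes fam: "orthonormal_eigenfamily A S (dim S) b m" and x: "x \<in> S"
  shows "x = (\<Sum>i<dim S. (x \<bullet> b i) *\<^sub>R b i)"
proof -
  note ind = orthonormal_eigenfamily_independent[OF fam order_refl]
  have ip: "b i \<bullet> b j = (if i = j then 1 else 0)" if "i < dim S" "j < dim S" for i j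
    using fam that by (auto simp: orthonormal_eigenfamily_def)
  let ?B = "b ` {..<dim S}"
  have "S \<subseteq> span ?B"
  proof (rule card_ge_dim_independent)
    show "?B \<subseteq> S" using fam by (auto simp: orthonormal_eigenfamily_def)
    show "dim S \<le> card ?B" by (simp add: card_image ind)
  qed (rule ind)
  then have "(\<Sum>v\<in>?B. (x \<bullet> v) *\<^sub>R v) = x"
    using x ip by (intro orthonormal_basis_expand)
      (auto simp: pairwise_def orthogonal_def norm_eq_1)
  then show ?thesis by (simp add: sum.reindex ind)
qed

lemma orthonormal_eigenfamily_forms:
  fixes A :: "real ^ 'n ^ 'n"
  assumes A: "transpose A = A" and fam: "orthonormal_eigenfamily A S (dim S) b m" and x: "x \<in> S"
  shows "x \<bullet> x = (\<Sum>i<dim S. (x \<bullet> b i)\<^sup>2)"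
    and "x \<bullet> (A *v x) = (\<Sum>i<dim S. m i * (x \<bullet> b i)\<^sup>2)"
proof -
  note expand = orthonormal_eigenfamily_expand[OF fam x]
  have "x \<bullet> x = x \<bullet> (\<Sum>i<dim S. (x \<bullet> b i) *\<^sub>R b i)" using expand by simp
  then show "x \<bullet> x = (\<Sum>i<dim S. (x \<bullet> b i)\<^sup>2)"
    by (simp add: inner_sum_right power2_eq_square)
  have eig: "(A *v x) \<bullet> b i = m i * (x \<bullet> b i)" if "i < dim S" for i
    using fam that symmetric_matrix_inner[OF A, of x "b i"]
    by (simp add: orthonormal_eigenfamily_def)
  have "x \<bullet> (A *v x) = (A *v x) \<bullet> (\<Sum>i<dim S. (x \<bullet> b i) *\<^sub>R b i)"
    using expand by (simp add: inner_commute)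
  then show "x \<bullet> (A *v x) = (\<Sum>i<dim S. m i * (x \<bullet> b i)\<^sup>2)"
    by (simp add: inner_sum_right eig power2_eq_square mult_ac)
qed

lemma count_mset_map_upt: "count (mset (map f [0..<n])) x = card {i. i < n \<and> f i = x}"
proof (induction n)
  case (Suc n)
  have "{i. i < Suc n \<and> f i = x} = {i. i < n \<and> f i = x} \<union> (if f n = x then {n} else {})"
    by (auto simp: less_Suc_eq)
  with Suc show ?case by (simp add: card_insert_if)
qed simp

text \<open>
  The eigenspace of \<open>\<mu>\<close> is spanned by the basis vectors whose eigenvalue is \<open>\<mu>\<close>, so geometric
  multiplicity counts the repetitions of \<open>\<mu>\<close> in \<open>m\<close>. This connects the multiset by which
  \<^const>\<open>lap_eigenvalue\<close> is defined to an eigenbasis.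
\<close>

lemma sorted_eigenvalues_eq:
  fixes A :: "real ^ 'n ^ 'n"
  assumes A: "transpose A = A" and fam: "orthonormal_eigenfamily A UNIV CARD('n) b m"
  shows "sorted_list_of_multiset (eigenvalue_mset A) = map m [0..<CARD('n)]"
proof -
  let ?n = "CARD('n)"
  have eig: "A *v b i = m i *\<^sub>R b i" and ip: "b i \<bullet> b i = 1" if "i < ?n" for i
    using fam that by (auto simp: orthonormal_eigenfamily_def)
  have expand: "x = (\<Sum>i<?n. (x \<bullet> b i) *\<^sub>R b i)" for x
    using orthonormal_eigenfamily_expand[of A UNIV b m x] fam by simp
  define I where "I = (\<lambda>\<mu>. {i. i < ?n \<and> m i = \<mu>})"
  have I: "I \<mu> \<subseteq> {..<?n}" for \<mu> by (auto simp: I_def)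
  have eigenspace: "eigenspace A \<mu> = span (b ` I \<mu>)" for \<mu>
  proof
    show "eigenspace A \<mu> \<subseteq> span (b ` I \<mu>)"
    proof
      fix x assume "x \<in> eigenspace A \<mu>"
      then have x: "A *v x = \<mu> *\<^sub>R x" by (simp add: eigenspace_def)
      have zero: "x \<bullet> b i = 0" if "i < ?n" "m i \<noteq> \<mu>" for i
        using symmetric_matrix_inner[OF A, of x "b i"] that by (simp add: x eig)
      have "(\<Sum>i<?n. (x \<bullet> b i) *\<^sub>R b i) \<in> span (b ` I \<mu>)"
      proof (rule span_sum)
        fix i assume "i \<in> {..<?n}"
        then show "(x \<bullet> b i) *\<^sub>R b i \<in> span (b ` I \<mu>)"
          using zero by (cases "m i = \<mu>") (simp_all add: I_def span_zero span_mul span_base)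
      qed
      then show "x \<in> span (b ` I \<mu>)" using expand[of x] by simp
    qed
    have "subspace (eigenspace A \<mu>)"
      by (auto simp: subspace_def eigenspace_def matrix_vector_right_distrib
          matrix_vector_mult_scaleR scaleR_add_right)
    then show "span (b ` I \<mu>) \<subseteq> eigenspace A \<mu>"
      using eig by (intro span_minimal) (auto simp: I_def eigenspace_def)
  qed
  have dim: "dim (eigenspace A \<mu>) = card (I \<mu>)" for \<mu>
    using orthonormal_eigenfamily_independent[OF fam I]
    by (simp add: eigenspace dim_eq_card_independent card_image)
  have ev: "is_eigenvalue A \<mu> \<longleftrightarrow> I \<mu> \<noteq> {}" for \<mu>
  proof
    assume "is_eigenvalue A \<mu>"
    then show "I \<mu> \<noteq> {}" by (auto simp: is_eigenvalue_def eigenspace)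
  next
    assume "I \<mu> \<noteq> {}"
    then obtain i where "i < ?n" "m i = \<mu>" by (auto simp: I_def)
    then have "b i \<noteq> 0" "b i \<in> eigenspace A \<mu>"
      using eig ip[of i] by (auto simp: eigenspace_def)
    then show "is_eigenvalue A \<mu>" by (auto simp: is_eigenvalue_def)
  qed
  have fin: "finite {\<mu>. is_eigenvalue A \<mu>}"
    by (rule finite_subset[of _ "m ` {..<?n}"]) (auto simp: ev I_def)
  have "eigenvalue_mset A = mset (map m [0..<?n])"
  proof (rule multiset_eqI)
    fix \<mu>
    have "count (eigenvalue_mset A) \<mu> = card (I \<mu>)"
      using fin ev[of \<mu>] by (auto simp: eigenvalue_mset_def count_sum dim if_distrib cong: if_cong)
    also have "\<dots> = count (mset (map m [0..<?n])) \<mu>"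
      unfolding I_def by (rule count_mset_map_upt[symmetric])
    finally show "count (eigenvalue_mset A) \<mu> = count (mset (map m [0..<?n])) \<mu>" .
  qed
  moreover have "sorted (map m [0..<?n])"
    using fam by (auto simp: orthonormal_eigenfamily_def sorted_iff_nth_mono)
  ultimately show ?thesis
    by (simp only: sorted_list_of_multiset_mset sorted_sort_id)
qed

section \<open>The Laplacian form and the extreme eigenvalues\<close>

definition sq_diff :: "real ^ 'v \<Rightarrow> 'v set \<Rightarrow> real" where
  "sq_diff \<phi> = on_edge (\<lambda>u v. (\<phi> $ u - \<phi> $ v)\<^sup>2)"

lemma sq_diff_pair: "sq_diff \<phi> {u, v} = (\<phi> $ u - \<phi> $ v)\<^sup>2"
  by (simp add: sq_diff_def on_edge_eq power2_commute)

lemma edgeE: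
  assumes "simple_graph E" "e \<in> E"
  obtains u v where "e = {u, v}"
  using assms by (auto simp: simple_graph_def card_2_iff)

lemma sq_diff_nonneg: "simple_graph E \<Longrightarrow> e \<in> E \<Longrightarrow> 0 \<le> sq_diff \<phi> e"
  by (metis edgeE sq_diff_pair zero_le_power2)

lemma sq_diff_scale:
  "simple_graph E \<Longrightarrow> e \<in> E \<Longrightarrow> sq_diff (c *\<^sub>R \<phi>) e = c\<^sup>2 * sq_diff \<phi> e"
  by (erule (1) edgeE) (simp add: sq_diff_pair power_mult_distrib flip: right_diff_distrib)

lemma continuous_on_sq_diff:
  assumes "simple_graph E" "e \<in> E"
  shows "continuous_on S (\<lambda>\<phi>. sq_diff \<phi> e)"
proof -
  obtain u v where "e = {u, v}" using assms by (rule edgeE)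
  then show ?thesis by (simp add: sq_diff_pair continuous_intros)
qed

definition dirichlet :: "'v set set \<Rightarrow> ('v set \<Rightarrow> real) \<Rightarrow> real ^ 'v \<Rightarrow> real" where
  "dirichlet E w \<phi> = (\<Sum>e\<in>E. w e * sq_diff \<phi> e)"

lemma laplacian_form:
  "simple_graph E \<Longrightarrow> \<phi> \<bullet> (laplacian E w *v \<phi>) = dirichlet E w \<phi>"
  by (simp add: laplacian_quadratic_form dirichlet_def sq_diff_def)

lemma dirichlet_affine:
  "dirichlet E (\<lambda>e. w e + t * z e) \<phi> = dirichlet E w \<phi> + t * dirichlet E z \<phi>"
  by (simp add: dirichlet_def algebra_simps sum.distrib sum_distrib_left)

lemma continuous_on_dirichlet: "simple_graph E \<Longrightarrow> continuous_on S (dirichlet E w)"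
  unfolding dirichlet_def by (intro continuous_intros continuous_on_sq_diff)

lemma dirichlet_nonneg:
  assumes "simple_graph E" "\<And>e. e \<in> E \<Longrightarrow> 0 \<le> w e"
  shows "0 \<le> dirichlet E w \<phi>"
  unfolding dirichlet_def using assms by (intro sum_nonneg mult_nonneg_nonneg sq_diff_nonneg)

text \<open>
  Adding a constant to a potential changes no difference along an edge, so the form is invariant
  under translation by the all-ones vector; polarization turns this into a kernel vector.
\<close>

lemma laplacian_one:
  assumes E: "simple_graph E"
  shows "laplacian E w *v 1 = 0"
proof -
  let ?L = "laplacian E w"
  have shift: "dirichlet E w (x + 1) = dirichlet E w x" and one: "dirichlet E w 1 = 0" for x
  proof -
    have "sq_diff (x + 1) e = sq_diff x e" "sq_diff 1 e = 0" if e: "e \<in> E" for e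
    proof -
      obtain u v where "e = {u, v}" using edgeE[OF E e] by blast
      then show "sq_diff (x + 1) e = sq_diff x e" "sq_diff 1 e = 0"
        by (simp_all add: sq_diff_pair)
    qed
    then show "dirichlet E w (x + 1) = dirichlet E w x" "dirichlet E w 1 = 0"
      by (simp_all add: dirichlet_def)
  qed
  have "(x + 1) \<bullet> (?L *v (x + 1)) = x \<bullet> (?L *v x) + 2 * (x \<bullet> (?L *v 1)) + 1 \<bullet> (?L *v 1)" for x
    using symmetric_matrix_inner[OF transpose_laplacian, of 1 E w x] inner_commute[of "?L *v 1" x]
    by (simp add: matrix_vector_right_distrib inner_add_left inner_add_right)
  then have "x \<bullet> (?L *v 1) = 0" for x
    by (simp add: laplacian_form[OF E] shift one)
  then show ?thesis by (metis inner_eq_zero_iff)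
qed

lemma laplacian_orthogonal_one:
  assumes "simple_graph E"
  shows "1 \<bullet> (laplacian E w *v \<phi>) = 0"
  by (simp add: symmetric_matrix_inner[OF transpose_laplacian] laplacian_one[OF assms])

lemma eigenvector_orthogonal_one:
  assumes "simple_graph E" "\<phi> \<in> eigenspace (laplacian E (\<lambda>_. 1)) \<mu>" "\<mu> \<noteq> 0"
  shows "1 \<bullet> \<phi> = 0"
  using laplacian_orthogonal_one[OF assms(1), of "\<lambda>_. 1" \<phi>] assms(2,3)
  by (simp add: eigenspace_def)

text \<open>
  One notion for both ends of the spectrum: for \<open>s = 1\<close>, \<open>\<mu>\<close> is the minimum of the Rayleigh
  quotient on the vectors orthogonal to the all-ones vector, and for \<open>s = -1\<close> the maximum. For
  nonnegative weights these are \<open>\<lambda>\<^sub>2(w)\<close> and \<open>\<lambda>\<^sub>n(w)\<close>. The sign lets a single argument cover lower and upper rigidity.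
\<close>

definition extremal_eigenvalue ::
    "real \<Rightarrow> 'v::finite set set \<Rightarrow> ('v set \<Rightarrow> real) \<Rightarrow> real \<Rightarrow> bool" where
  "extremal_eigenvalue s E w \<mu> \<longleftrightarrow>
     (\<exists>\<phi>. norm \<phi> = 1 \<and> 1 \<bullet> \<phi> = 0 \<and> \<phi> \<in> eigenspace (laplacian E w) \<mu>) \<and>
     (\<forall>\<phi>. 1 \<bullet> \<phi> = 0 \<longrightarrow> s * \<mu> * (\<phi> \<bullet> \<phi>) \<le> s * dirichlet E w \<phi>)"

text \<open>
  A sorted eigenbasis of the complement of the all-ones vector, preceded by the normalized all-ones
  vector with its eigenvalue 0, is a sorted eigenbasis of the whole space; nonnegative weights are
  what makes 0 the smallest eigenvalue. Hence \<open>\<lambda>\<^sub>2(w)\<close> and \<open>\<lambda>\<^sub>n(w)\<close> are the first and the last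
  eigenvalue on the complement, and expanding in the basis shows that they bound the Rayleigh
  quotient there.
\<close>

lemma
  fixes E :: "'v::finite set set"
  assumes n: "CARD('v) \<ge> 2" and E: "simple_graph E"
    and w: "\<And>e. e \<in> E \<Longrightarrow> 0 \<le> w e"
  shows extremal_lap_eigenvalue_2: "extremal_eigenvalue 1 E w (lap_eigenvalue E w 2)"
    and extremal_lap_eigenvalue_CARD: "extremal_eigenvalue (-1) E w (lap_eigenvalue E w CARD('v))"
proof -
  define A where "A = laplacian E w"
  define S where "S = {\<phi> :: real ^ 'v. 1 \<bullet> \<phi> = 0}"
  have A: "transpose A = A" by (simp add: A_def transpose_laplacian)
  have one: "(1 :: real ^ 'v) \<bullet> 1 = CARD('v)" by (simp add: inner_vec_def)
  then have "dim S = CARD('v) - 1"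
    unfolding S_def by (subst dim_hyperplane) auto
  then obtain k where k: "dim S = Suc k" "CARD('v) = Suc (Suc k)"
    using n by (metis Suc_diff_le Suc_eq_plus1 add_2_eq_Suc' le_Suc_ex diff_Suc_1 numeral_2_eq_2 add.commute)
  have "subspace S"
    unfolding S_def by (rule subspace_hyperplane)
  have inv: "A *v y \<in> S" for y
    using laplacian_orthogonal_one[OF E, of w y] by (simp add: A_def S_def)
  obtain b m where fam: "orthonormal_eigenfamily A S (dim S) b m"
    using sorted_eigenfamily_exists[OF A \<open>subspace S\<close>] inv by blast
  define x :: "real ^ 'v" where "x = (1 / sqrt CARD('v)) *\<^sub>R 1"
  have "orthonormal_eigenfamily A UNIV (Suc (dim S)) (case_nat x b) (case_nat 0 m)"
  proof (rule orthonormal_eigenfamily_Cons[OF fam])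
    show "norm x = 1" using one by (simp add: x_def norm_eq_sqrt_inner)
    show "A *v x = 0 *\<^sub>R x"
      using laplacian_one[OF E, of w] by (simp add: A_def x_def matrix_vector_mult_scaleR)
    show "x \<bullet> y = 0" if "y \<in> S" for y using that by (simp add: S_def x_def)
    show "0 * (y \<bullet> y) \<le> y \<bullet> (A *v y)" for y
      using dirichlet_nonneg[of E w] E w by (simp add: A_def laplacian_form[OF E])
  qed auto
  then have "sorted_list_of_multiset (eigenvalue_mset A) = map (case_nat 0 m) [0..<CARD('v)]"
    using sorted_eigenvalues_eq[OF A] k by simp
  then have lap: "lap_eigenvalue E w j = (case j - 1 of 0 \<Rightarrow> 0 | Suc i \<Rightarrow> m i)"
    if "j - 1 < CARD('v)" for j
    using that by (simp add: lap_eigenvalue_def A_def[symmetric] del: upt_Suc)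
  have b: "norm (b i) = 1" "1 \<bullet> b i = 0" "b i \<in> eigenspace A (m i)" if "i \<le> k" for i
    using fam[unfolded k(1)] that
    by (auto simp: orthonormal_eigenfamily_def S_def norm_eq_1 eigenspace_def)
  have mono: "m 0 \<le> m i" "m i \<le> m k" if "i < Suc k" for i
    using fam[unfolded k(1)] that by (auto simp: orthonormal_eigenfamily_def)
  have forms: "\<phi> \<bullet> \<phi> = (\<Sum>i<Suc k. (\<phi> \<bullet> b i)\<^sup>2)"
    "dirichlet E w \<phi> = (\<Sum>i<Suc k. m i * (\<phi> \<bullet> b i)\<^sup>2)" if "1 \<bullet> \<phi> = 0" for \<phi>
    using orthonormal_eigenfamily_forms[OF A fam, of \<phi>] that
    unfolding k(1) by (simp_all add: S_def A_def laplacian_form[OF E] del: sum.lessThan_Suc)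
  have low: "m 0 * (\<phi> \<bullet> \<phi>) \<le> dirichlet E w \<phi>" and upp: "dirichlet E w \<phi> \<le> m k * (\<phi> \<bullet> \<phi>)"
    if "1 \<bullet> \<phi> = 0" for \<phi>
    unfolding forms[OF that] sum_distrib_left
    using mono by (auto intro!: sum_mono mult_right_mono simp del: sum.lessThan_Suc)
  show "extremal_eigenvalue 1 E w (lap_eigenvalue E w 2)"
    using b[of 0] low k by (auto simp: extremal_eigenvalue_def lap A_def)
  show "extremal_eigenvalue (-1) E w (lap_eigenvalue E w CARD('v))"
    using b[of k] upp k by (auto simp: extremal_eigenvalue_def lap A_def)
qed

text \<open>
  A unit eigenvector with eigenvalue at most 0 would have no difference along any edge, hence be
  constant on a connected graph, which contradicts orthogonality to the all-ones vector.
\<close>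

lemma extremal_eigenvalue_pos:
  fixes E :: "'v::finite set set"
  assumes E: "simple_graph E" and conn: "connected_graph E"
    and ext: "extremal_eigenvalue s E (\<lambda>_. 1) \<mu>"
  shows "\<mu> > 0"
proof (rule ccontr)
  assume "\<not> \<mu> > 0"
  obtain \<phi> where \<phi>: "norm \<phi> = 1" "1 \<bullet> \<phi> = 0" "\<phi> \<in> eigenspace (laplacian E (\<lambda>_. 1)) \<mu>"
    using ext by (auto simp: extremal_eigenvalue_def)
  have "dirichlet E (\<lambda>_. 1) \<phi> = \<mu>"
    using \<phi> by (simp add: laplacian_form[OF E, symmetric] eigenspace_def norm_eq_1)
  then have "(\<Sum>e\<in>E. sq_diff \<phi> e) = 0"
    using \<open>\<not> \<mu> > 0\<close> sum_nonneg[of E "sq_diff \<phi>"] sq_diff_nonneg[OF E]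
    by (force simp: dirichlet_def)
  then have zero: "sq_diff \<phi> e = 0" if "e \<in> E" for e
    using that sum_nonneg_eq_0_iff[of E "sq_diff \<phi>"] sq_diff_nonneg[OF E] by auto
  have "\<phi> $ u = \<phi> $ v" for u v
  proof -
    have "(u, v) \<in> {(x, y). {x, y} \<in> E}\<^sup>*" using conn by (simp add: connected_graph_def)
    then show ?thesis
    proof induction
      case (step y z)
      then show ?case using zero[of "{y, z}"] by (simp add: sq_diff_pair)
    qed simp
  qed
  then obtain c where c: "\<And>v. \<phi> $ v = c" by metis
  then have "c = 0" using \<phi>(2) by (simp add: inner_vec_def)
  then have "\<phi> = 0" using c by (simp add: vec_eq_iff)
  then show False using \<phi>(1) by simp
qed

section \<open>Edge-isometric embeddings from rigidity\<close>

text \<open>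
  Both signs reduce to the minimization principle, applied to the matrix \<open>s L\<close> on the complement
  of the all-ones vector.
\<close>

lemma extremal_form_attained_eigenspace:
  fixes E :: "'v::finite set set"
  assumes E: "simple_graph E" and "s \<noteq> 0" and ext: "extremal_eigenvalue s E (\<lambda>_. 1) \<mu>"
    and \<phi>: "1 \<bullet> \<phi> = 0" "dirichlet E (\<lambda>_. 1) \<phi> = \<mu> * (\<phi> \<bullet> \<phi>)"
  shows "\<phi> \<in> eigenspace (laplacian E (\<lambda>_. 1)) \<mu>"
proof -
  define L where "L = laplacian E (\<lambda>_. 1)"
  have sL: "(s *\<^sub>R L) *v x = s *\<^sub>R (L *v x)" for x
    by (simp add: scaleR_matrix_vector_assoc)
  have form: "x \<bullet> (L *v x) = dirichlet E (\<lambda>_. 1) x" for x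
    by (simp add: L_def laplacian_form[OF E])
  have "(s *\<^sub>R L) *v \<phi> = (s * \<mu>) *\<^sub>R \<phi>"
  proof (rule minimizer_is_eigenvector)
    show "transpose (s *\<^sub>R L) = s *\<^sub>R L"
      using transpose_laplacian[of E "\<lambda>_. 1"] by (simp add: L_def transpose_def vec_eq_iff)
    show "subspace {x :: real ^ 'v. 1 \<bullet> x = 0}" by (rule subspace_hyperplane)
    show "(s *\<^sub>R L) *v x \<in> {x. 1 \<bullet> x = 0}" for x
      unfolding sL using laplacian_orthogonal_one[OF E, of "\<lambda>_. 1"] by (simp add: L_def)
    show "s * \<mu> * (y \<bullet> y) \<le> y \<bullet> ((s *\<^sub>R L) *v y)" if "y \<in> {x. 1 \<bullet> x = 0}" for y
      using ext that by (simp add: sL form extremal_eigenvalue_def)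
  qed (use \<phi> in \<open>simp_all add: sL form\<close>)
  then have "s *\<^sub>R (L *v \<phi>) = s *\<^sub>R (\<mu> *\<^sub>R \<phi>)" by (simp add: sL)
  then have "L *v \<phi> = \<mu> *\<^sub>R \<phi>" using \<open>s \<noteq> 0\<close> unfolding scaleR_cancel_left by blast
  then show ?thesis by (simp add: eigenspace_def L_def)
qed

text \<open>
  First-order perturbation theory by compactness. On the unit vectors orthogonal to the all-ones
  vector where the perturbation \<open>z\<close> does not help, the unperturbed form stays away from its
  extremal value: that value is attained only in the eigenspace, where \<open>z\<close> does help. The gap
  absorbs a small perturbation there, and elsewhere the perturbation moves the form in the
  desired direction.
\<close>

lemma improving_perturbation:
  fixes E :: "'v::finite set set"
  assumes E: "simple_graph E" and "s \<noteq> 0" and ext: "extremal_eigenvalue s E (\<lambda>_. 1) \<mu>"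
    and z: "\<And>\<phi>. \<phi> \<in> eigenspace (laplacian E (\<lambda>_. 1)) \<mu> \<Longrightarrow> norm \<phi> = 1 \<Longrightarrow> 0 < s * dirichlet E z \<phi>"
  obtains \<epsilon> where "\<epsilon> > 0" "\<And>e. e \<in> E \<Longrightarrow> 0 \<le> 1 + \<epsilon> * z e"
    "\<And>\<phi>. 1 \<bullet> \<phi> = 0 \<Longrightarrow> norm \<phi> = 1 \<Longrightarrow> s * \<mu> < s * dirichlet E (\<lambda>e. 1 + \<epsilon> * z e) \<phi>"
proof -
  let ?Q = "\<lambda>\<phi>. s * dirichlet E (\<lambda>_. 1) \<phi>" and ?Z = "\<lambda>\<phi>. s * dirichlet E z \<phi>"
  define K where "K = {\<phi> :: real ^ 'v. 1 \<bullet> \<phi> = 0} \<inter> sphere 0 1"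
  define T where "T = K \<inter> {\<phi>. ?Z \<phi> \<le> 0}"
  have cont: "continuous_on X ?Q" "continuous_on X ?Z" for X
    by (auto intro!: continuous_intros continuous_on_dirichlet E)
  have K: "compact K"
    unfolding K_def by (intro closed_Int_compact closed_hyperplane compact_sphere)
  have "closed {\<phi>. ?Z \<phi> \<le> 0}"
    using cont(2)[of UNIV] by (intro closed_Collect_le) auto
  then have T: "compact T" unfolding T_def using K by (simp add: compact_Int_closed)
  have Q_ge: "s * \<mu> \<le> ?Q \<phi>" if "\<phi> \<in> K" for \<phi>
    using ext that by (auto simp: extremal_eigenvalue_def K_def norm_eq_1)
  have Q_gt: "s * \<mu> < ?Q \<phi>" if "\<phi> \<in> T" for \<phi>
  proof (rule ccontr)
    assume "\<not> s * \<mu> < ?Q \<phi>"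
    moreover have K': "\<phi> \<in> K" using that by (simp add: T_def)
    ultimately have "s * dirichlet E (\<lambda>_. 1) \<phi> = s * \<mu>" using Q_ge by force
    then have "\<phi> \<in> eigenspace (laplacian E (\<lambda>_. 1)) \<mu>"
      using K' \<open>s \<noteq> 0\<close>
      by (intro extremal_form_attained_eigenspace[OF E \<open>s \<noteq> 0\<close> ext]) (auto simp: K_def norm_eq_1)
    from z[OF this] K' that show False by (simp add: K_def T_def)
  qed
  obtain \<eta> where \<eta>: "\<eta> > 0" "\<And>\<phi>. \<phi> \<in> T \<Longrightarrow> s * \<mu> + \<eta> \<le> ?Q \<phi>"
  proof (cases "T = {}")
    case True
    then show ?thesis using that[of 1] by simp
  next
    case False
    then obtain \<phi> where \<phi>: "\<phi> \<in> T" "\<And>\<psi>. \<psi> \<in> T \<Longrightarrow> ?Q \<phi> \<le> ?Q \<psi>"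
      using continuous_attains_inf[OF T False cont(1)] by blast
    show ?thesis using Q_gt[OF \<phi>(1)] \<phi>(2) by (intro that[of "?Q \<phi> - s * \<mu>"]) auto
  qed
  obtain M where M: "M > 0" "\<And>\<phi>. \<phi> \<in> K \<Longrightarrow> \<bar>?Z \<phi>\<bar> \<le> M"
    using compact_imp_bounded[OF compact_continuous_image[OF cont(2) K]]
    by (auto simp: bounded_pos)
  \<comment> \<open>The bound \<open>1 / B\<close> on \<open>\<epsilon>\<close> keeps the weights nonnegative, and \<open>\<eta> / (2 M)\<close> keeps the
    perturbation below the gap \<open>\<eta>\<close>.\<close>
  define B where "B = 1 + (\<Sum>e\<in>E. \<bar>z e\<bar>)"
  have "0 \<le> (\<Sum>e\<in>E. \<bar>z e\<bar>)" by (rule sum_nonneg) simp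
  then have B0: "B > 0" unfolding B_def by linarith
  have B: "\<bar>z e\<bar> \<le> B" if "e \<in> E" for e
    using member_le_sum[OF that, of "\<lambda>e. \<bar>z e\<bar>"] by (simp add: B_def)
  define \<epsilon> where "\<epsilon> = min (1 / B) (\<eta> / (2 * M))"
  have \<epsilon>: "\<epsilon> > 0" "\<epsilon> * B \<le> 1" "\<epsilon> * M < \<eta>"
  proof -
    show "\<epsilon> > 0" using B0 \<eta>(1) M(1) by (simp add: \<epsilon>_def)
    have "\<epsilon> * B \<le> 1 / B * B" using B0 by (intro mult_right_mono) (auto simp: \<epsilon>_def)
    then show "\<epsilon> * B \<le> 1" using B0 by simp
    have "\<epsilon> * M \<le> \<eta> / (2 * M) * M" using M(1) by (intro mult_right_mono) (auto simp: \<epsilon>_def)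
    then show "\<epsilon> * M < \<eta>" using M(1) \<eta>(1) by simp
  qed
  show ?thesis
  proof (rule that[OF \<epsilon>(1)])
    fix e assume "e \<in> E"
    have "\<bar>\<epsilon> * z e\<bar> \<le> \<epsilon> * B"
      using B[OF \<open>e \<in> E\<close>] \<epsilon>(1) by (simp add: abs_mult)
    then show "0 \<le> 1 + \<epsilon> * z e" using \<epsilon>(2) by linarith
  next
    fix \<phi> :: "real ^ 'v" assume "1 \<bullet> \<phi> = 0" "norm \<phi> = 1"
    then have \<phi>: "\<phi> \<in> K" by (simp add: K_def)
    have "s * \<mu> < ?Q \<phi> + \<epsilon> * ?Z \<phi>"
    proof (cases "\<phi> \<in> T")
      case True
      have "\<bar>\<epsilon> * ?Z \<phi>\<bar> \<le> \<epsilon> * M"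
        using M(2)[OF \<phi>] \<epsilon>(1) by (simp add: abs_mult del: abs_mult_pos)
      then show ?thesis using \<eta>(2)[OF True] \<epsilon>(3) by linarith
    next
      case False
      then have "0 < \<epsilon> * ?Z \<phi>" using \<phi> \<epsilon>(1) by (simp add: T_def)
      then show ?thesis using Q_ge[OF \<phi>] by linarith
    qed
    then show "s * \<mu> < s * dirichlet E (\<lambda>e. 1 + \<epsilon> * z e) \<phi>"
      by (simp add: dirichlet_affine algebra_simps)
  qed
qed

text \<open>
  The squared edge differences of the columns of an embedding add up, so up to scaling the possible
  vectors of squared edge lengths form the convex hull of those of unit eigenvectors. A unit
  eigenvector has squared differences summing to its eigenvalue \<open>\<mu>\<close>, so the only candidate for a
  constant vector in this hull has all entries \<open>\<mu> / card E\<close>. If it is missing, a separating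
  hyperplane, recentred to have total weight 0, is a direction in which the weights can be moved
  to improve the extremal eigenvalue, contrary to rigidity.
\<close>

lemma rigid_imp_edge_isometric:
  fixes E :: "'v::finite set set"
  assumes E: "simple_graph E" and ne: "E \<noteq> {}" and "s \<noteq> 0"
    and ext: "\<And>w. normalized_weight E w \<Longrightarrow> extremal_eigenvalue s E w (\<Lambda> w)"
    and rigid: "\<And>w. normalized_weight E w \<Longrightarrow> s * \<Lambda> w \<le> s * \<Lambda> (\<lambda>_. 1)"
  obtains r :: nat and \<phi> where "\<And>i. i < r \<Longrightarrow> \<phi> i \<in> eigenspace (laplacian E (\<lambda>_. 1)) (\<Lambda> (\<lambda>_. 1))"
    "\<And>e. e \<in> E \<Longrightarrow> (\<Sum>i<r. sq_diff (\<phi> i) e) = \<Lambda> (\<lambda>_. 1) / card E"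
proof -
  define \<mu> where "\<mu> = \<Lambda> (\<lambda>_. 1)"
  define U where "U = eigenspace (laplacian E (\<lambda>_. 1)) \<mu> \<inter> sphere 0 1"
  define q :: "real ^ 'v \<Rightarrow> real ^ 'v set" where "q = (\<lambda>\<phi>. \<chi> e. if e \<in> E then sq_diff \<phi> e else 0)"
  define y :: "real ^ 'v set" where "y = (\<chi> e. if e \<in> E then \<mu> / card E else 0)"
  have card: "card E > 0" using ne by (simp add: card_gt_0_iff)
  have ext1: "extremal_eigenvalue s E (\<lambda>_. 1) \<mu>"
    unfolding \<mu>_def by (rule ext) (simp add: normalized_weight_def)
  have "compact U"
    unfolding U_def by (intro closed_Int_compact closed_subspace compact_sphere)
      (auto simp: subspace_def eigenspace_def matrix_vector_right_distrib
        matrix_vector_mult_scaleR scaleR_add_right)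
  moreover have "continuous_on U q"
    unfolding q_def
  proof (rule continuous_on_vec_lambda)
    show "continuous_on U (\<lambda>\<phi>. if e \<in> E then sq_diff \<phi> e else 0)" for e
      by (cases "e \<in> E") (simp_all add: continuous_on_sq_diff[OF E])
  qed
  ultimately have "compact (convex hull (q ` U))"
    by (intro compact_convex_hull compact_continuous_image)
  then have closed: "closed (convex hull (q ` U))" by (rule compact_imp_closed)
  have "y \<in> convex hull (q ` U)"
  proof (rule ccontr)
    assume "y \<notin> convex hull (q ` U)"
    then obtain a b where ab: "a \<bullet> y < b" "\<And>x. x \<in> convex hull (q ` U) \<Longrightarrow> b < a \<bullet> x"
      using separating_hyperplane_closed_point[OF convex_convex_hull closed] by blast
    \<comment> \<open>Subtracting the mean \<open>\<alpha>\<close> shifts \<open>a \<bullet> q \<phi>\<close> and \<open>a \<bullet> y\<close> equally, since the entries of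
      \<open>q \<phi>\<close> and of \<open>y\<close> both sum to \<open>\<mu>\<close>.\<close>
    define \<alpha> where "\<alpha> = (\<Sum>e\<in>E. a $ e) / card E"
    define z where "z = (\<lambda>e. s * (a $ e - \<alpha>))"
    have z0: "(\<Sum>e\<in>E. z e) = 0"
      using card by (simp add: z_def \<alpha>_def sum_subtractf flip: sum_distrib_left)
    have ay: "a \<bullet> y = \<alpha> * \<mu>"
    proof -
      have "a \<bullet> y = (\<Sum>e\<in>E. a $ e * (\<mu> / card E))"
        by (simp add: inner_vec_def y_def if_distrib[of "(*) _"] sum.If_cases cong: if_cong)
      also have "\<dots> = \<alpha> * \<mu>" by (simp add: \<alpha>_def sum_distrib_right sum_divide_distrib)
      finally show ?thesis .
    qed
    have "0 < s * dirichlet E z \<phi>"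
      if "\<phi> \<in> eigenspace (laplacian E (\<lambda>_. 1)) \<mu>" "norm \<phi> = 1" for \<phi>
    proof -
      have "dirichlet E (\<lambda>_. 1) \<phi> = \<mu>"
        using that by (simp add: laplacian_form[OF E, symmetric] eigenspace_def norm_eq_1)
      then have "(\<Sum>e\<in>E. sq_diff \<phi> e) = \<mu>" by (simp add: dirichlet_def)
      moreover have "dirichlet E z \<phi> =
          s * ((\<Sum>e\<in>E. a $ e * sq_diff \<phi> e) - \<alpha> * (\<Sum>e\<in>E. sq_diff \<phi> e))"
        by (simp add: dirichlet_def z_def algebra_simps sum_subtractf sum_distrib_left)
      moreover have "a \<bullet> q \<phi> = (\<Sum>e\<in>E. a $ e * sq_diff \<phi> e)"
        by (simp add: inner_vec_def q_def if_distrib[of "(*) _"] sum.If_cases cong: if_cong)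
      ultimately have "dirichlet E z \<phi> = s * (a \<bullet> q \<phi> - a \<bullet> y)"
        by (simp add: ay)
      moreover have "a \<bullet> y < a \<bullet> q \<phi>"
        using ab that by (force simp: U_def intro: hull_inc)
      ultimately show ?thesis
        using \<open>s \<noteq> 0\<close> by (auto simp: zero_less_mult_iff mult_less_0_iff linorder_neq_iff)
    qed
    then obtain \<epsilon> where \<epsilon>: "\<epsilon> > 0" "\<And>e. e \<in> E \<Longrightarrow> 0 \<le> 1 + \<epsilon> * z e"
      "\<And>\<phi>. 1 \<bullet> \<phi> = 0 \<Longrightarrow> norm \<phi> = 1 \<Longrightarrow> s * \<mu> < s * dirichlet E (\<lambda>e. 1 + \<epsilon> * z e) \<phi>"
      using improving_perturbation[OF E \<open>s \<noteq> 0\<close> ext1] by metis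
    define w where "w = (\<lambda>e. 1 + \<epsilon> * z e)"
    have w: "normalized_weight E w"
      using \<epsilon>(2) z0 by (simp add: normalized_weight_def w_def sum.distrib flip: sum_distrib_left)
    then obtain \<phi> where \<phi>: "norm \<phi> = 1" "1 \<bullet> \<phi> = 0" "\<phi> \<in> eigenspace (laplacian E w) (\<Lambda> w)"
      using ext by (auto simp: extremal_eigenvalue_def)
    have "dirichlet E w \<phi> = \<Lambda> w"
      using \<phi> by (simp add: laplacian_form[OF E, symmetric] eigenspace_def norm_eq_1)
    then show False
      using \<epsilon>(3)[OF \<phi>(2,1)] rigid[OF w] by (simp add: w_def \<mu>_def)
  qed
  \<comment> \<open>A convex combination of squared differences is realized by scaling the eigenvectors with the
    square roots of its coefficients.\<close>
  then obtain k u x where kux: "\<And>i. i \<in> {1..k::nat} \<Longrightarrow> 0 \<le> u i \<and> x i \<in> q ` U"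
    "(\<Sum>i\<in>{1..k}. u i *\<^sub>R x i) = y"
    unfolding convex_hull_indexed by blast
  have "\<exists>f. \<forall>i\<in>{1..k}. f i \<in> U \<and> x i = q (f i)"
    using kux(1) by (intro bchoice) blast
  then obtain f where f: "\<And>i. i \<in> {1..k} \<Longrightarrow> f i \<in> U \<and> x i = q (f i)" by blast
  show ?thesis
  proof (rule that[of k "\<lambda>i. sqrt (u (Suc i)) *\<^sub>R f (Suc i)"])
    fix i assume "i < k"
    then show "sqrt (u (Suc i)) *\<^sub>R f (Suc i) \<in> eigenspace (laplacian E (\<lambda>_. 1)) (\<Lambda> (\<lambda>_. 1))"
      using f[of "Suc i"] by (simp add: U_def eigenspace_def \<mu>_def matrix_vector_mult_scaleR)
  next
    fix e assume e: "e \<in> E"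
    have "(\<Sum>i<k. sq_diff (sqrt (u (Suc i)) *\<^sub>R f (Suc i)) e) =
        (\<Sum>i<k. u (Suc i) * (x (Suc i) $ e))"
      using f kux(1) e by (intro sum.cong) (auto simp: sq_diff_scale[OF E] q_def)
    also have "\<dots> = (\<Sum>i\<in>{1..k}. u i *\<^sub>R x i) $ e"
      by (simp add: sum.atLeast1_atMost_eq)
    also have "\<dots> = \<Lambda> (\<lambda>_. 1) / card E" unfolding kux(2) using e by (simp add: y_def \<mu>_def)
    finally show "(\<Sum>i<k. sq_diff (sqrt (u (Suc i)) *\<^sub>R f (Suc i)) e) = \<Lambda> (\<lambda>_. 1) / card E" .
  qed
qed

section \<open>Rigidity from orbit averages\<close>

text \<open>
  Averaging over the group is averaging over the orbit. The sum over \<open>G\<close> is constant on the orbit,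
  and each group element permutes the orbit, so summing \<open>f (g ` x)\<close> over all \<open>g\<close> and \<open>x\<close> in both
  orders gives the identity.
\<close>

lemma group_average_eq_orbit_average:
  fixes G :: "('v::finite \<Rightarrow> 'v) set" and f :: "'v set \<Rightarrow> real" and e :: "'v set"
  assumes bij: "\<And>g. g \<in> G \<Longrightarrow> bij g" and comp: "\<And>g h. g \<in> G \<Longrightarrow> h \<in> G \<Longrightarrow> g \<circ> h \<in> G"
  defines "Orb \<equiv> {g ` e | g. g \<in> G}"
  shows "real (card Orb) * (\<Sum>g\<in>G. f (g ` e)) = real (card G) * (\<Sum>x\<in>Orb. f x)"
proof -
  have const: "(\<Sum>g\<in>G. f (g ` x)) = (\<Sum>g\<in>G. f (g ` e))" if "x \<in> Orb" for x
  proof -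
    obtain h where h: "h \<in> G" "x = h ` e" using \<open>x \<in> Orb\<close> by (auto simp: Orb_def)
    have "inj_on (\<lambda>g. g \<circ> h) G"
      using bij_is_surj[OF bij[OF h(1)]] by (intro inj_onI) (auto simp: fun_eq_iff, metis surjD)
    moreover have "(\<lambda>g. g \<circ> h) ` G \<subseteq> G" using comp h(1) by auto
    ultimately have "bij_betw (\<lambda>g. g \<circ> h) G G"
      by (simp add: bij_betw_def endo_inj_surj)
    from sum.reindex_bij_betw[OF this, of "\<lambda>g. f (g ` e)"] show ?thesis
      by (simp add: h(2) image_comp)
  qed
  have perm: "(\<Sum>x\<in>Orb. f (g ` x)) = (\<Sum>x\<in>Orb. f x)" if "g \<in> G" for g
  proof -
    have "inj_on (image g) Orb"
      using bij_is_inj[OF bij[OF that]] by (simp add: inj_on_def inj_image_eq_iff)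
    moreover have "g ` h ` e \<in> Orb" if "h \<in> G" for h
      using comp[OF \<open>g \<in> G\<close> that] unfolding Orb_def image_comp by blast
    then have "image g ` Orb \<subseteq> Orb" by (auto simp: Orb_def)
    ultimately have "bij_betw (image g) Orb Orb"
      by (simp add: bij_betw_def endo_inj_surj)
    from sum.reindex_bij_betw[OF this, of f] show ?thesis .
  qed
  have "real (card Orb) * (\<Sum>g\<in>G. f (g ` e)) = (\<Sum>x\<in>Orb. \<Sum>g\<in>G. f (g ` x))"
    by (simp add: const)
  also have "\<dots> = (\<Sum>g\<in>G. \<Sum>x\<in>Orb. f (g ` x))" by (rule sum.swap)
  also have "\<dots> = real (card G) * (\<Sum>x\<in>Orb. f x)" by (simp add: perm)
  finally show ?thesis .
qed

lemma
  fixes E :: "'v::finite set set"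
  assumes "subgroup \<Psi> (aut_group E)"
  shows automorphism_bij: "g \<in> \<Psi> \<Longrightarrow> bij g"
    and automorphism_edge: "simple_graph E \<Longrightarrow> g \<in> \<Psi> \<Longrightarrow> e \<in> E \<Longrightarrow> g ` e \<in> E"
    and automorphism_comp: "g \<in> \<Psi> \<Longrightarrow> h \<in> \<Psi> \<Longrightarrow> g \<circ> h \<in> \<Psi>"
    and automorphism_nonempty: "\<Psi> \<noteq> {}"
    and edge_orbits_eq: "edge_orbits E \<Psi> = {{g ` e | g. g \<in> \<Psi>} | e. e \<in> E}"
proof -
  have aut: "g \<in> Bij UNIV" "{g u, g v} \<in> E \<longleftrightarrow> {u, v} \<in> E" if "g \<in> \<Psi>" for g u v
    using subgroup.subset[OF assms] that by (auto simp: aut_group_def)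
  show "bij g" if "g \<in> \<Psi>" for g using aut(1)[OF that] by (simp add: Bij_def)
  show "g ` e \<in> E" if "simple_graph E" "g \<in> \<Psi>" "e \<in> E" for g e
    using edgeE[OF that(1,3)] aut(2)[OF that(2)] that(3) by (metis image_insert image_empty)
  show "g \<circ> h \<in> \<Psi>" if "g \<in> \<Psi>" "h \<in> \<Psi>" for g h
    using subgroup.m_closed[OF assms that] aut(1) that
    by (simp add: aut_group_def BijGroup_def compose_def comp_def restrict_UNIV)
  show "\<Psi> \<noteq> {}" using subgroup.one_closed[OF assms] by blast
  show "edge_orbits E \<Psi> = {{g ` e | g. g \<in> \<Psi>} | e. e \<in> E}"
    by (simp add: edge_orbits_def orbits_def orbit_def)
qed

lemma permute_vertices:
  fixes \<phi> :: "real ^ 'v" and g :: "'v \<Rightarrow> 'v"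
  assumes "bij g"
  defines "\<psi> \<equiv> \<chi> v. \<phi> $ g v"
  shows "\<psi> \<bullet> \<psi> = \<phi> \<bullet> \<phi>" "1 \<bullet> \<psi> = 1 \<bullet> \<phi>"
    and "simple_graph E \<Longrightarrow> e \<in> E \<Longrightarrow> sq_diff \<psi> e = sq_diff \<phi> (g ` e)"
proof -
  have "\<psi> \<bullet> \<psi> = (\<Sum>v\<in>UNIV. \<phi> $ g v * \<phi> $ g v)" by (simp add: \<psi>_def inner_vec_def)
  also have "\<dots> = \<phi> \<bullet> \<phi>"
    unfolding inner_vec_def inner_real_def
    by (rule sum.reindex_bij_betw[OF assms(1), of "\<lambda>v. \<phi> $ v * \<phi> $ v"])
  finally show "\<psi> \<bullet> \<psi> = \<phi> \<bullet> \<phi>" .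
  have "1 \<bullet> \<psi> = (\<Sum>v\<in>UNIV. \<phi> $ g v)" by (simp add: \<psi>_def inner_vec_def)
  also have "\<dots> = (\<Sum>v\<in>UNIV. \<phi> $ v)"
    by (rule sum.reindex_bij_betw[OF assms(1), of "\<lambda>v. \<phi> $ v"])
  finally show "1 \<bullet> \<psi> = 1 \<bullet> \<phi>" by (simp add: inner_vec_def)
  show "sq_diff \<psi> e = sq_diff \<phi> (g ` e)" if "simple_graph E" "e \<in> E"
  proof -
    obtain u v where "e = {u, v}" using edgeE \<open>simple_graph E\<close> \<open>e \<in> E\<close> by blast
    then show ?thesis by (simp add: \<psi>_def sq_diff_pair)
  qed
qed

text \<open>
  Replacing the columns \<open>\<phi> i\<close> by all their translates \<open>\<psi> g i\<close> under \<open>G\<close> gives an embedding in which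
  all edges have the same squared length \<open>c\<close>. Its total energy is therefore \<open>c\<close> times the total weight,
  the same for every normalized weight. For the unit weight the energy is \<open>\<mu>\<close> times the total
  squared norm \<open>N\<close>, and for any other weight the extremal eigenvalue \<open>\<nu>\<close> bounds it by
  \<open>\<nu> N\<close> from the side given by \<open>s\<close>.
\<close>

lemma averaged_isometric_imp_rigid:
  fixes E :: "'v::finite set set" and \<phi> :: "nat \<Rightarrow> real ^ 'v"
  assumes E: "simple_graph E" and ne: "E \<noteq> {}"
    and G: "G \<noteq> {}" "\<And>g. g \<in> G \<Longrightarrow> bij g"
    and w: "normalized_weight E w" and ext: "extremal_eigenvalue s E w \<nu>"
    and \<phi>: "\<And>i. i < r \<Longrightarrow> \<phi> i \<in> eigenspace (laplacian E (\<lambda>_. 1)) \<mu>" and "\<mu> > 0" and "c > 0"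
    and iso: "\<And>e. e \<in> E \<Longrightarrow> (\<Sum>g\<in>G. \<Sum>i<r. sq_diff (\<phi> i) (g ` e)) = c"
    and total: "\<And>g. g \<in> G \<Longrightarrow> image g ` E = E"
  shows "s * \<nu> \<le> s * \<mu>"
proof -
  define \<psi> :: "('v \<Rightarrow> 'v) \<Rightarrow> nat \<Rightarrow> real ^ 'v" where "\<psi> = (\<lambda>g i. \<chi> v. \<phi> i $ g v)"
  define N where "N = real (card G) * (\<Sum>i<r. \<phi> i \<bullet> \<phi> i)"
  have perm: "\<psi> g i \<bullet> \<psi> g i = \<phi> i \<bullet> \<phi> i" "1 \<bullet> \<psi> g i = 1 \<bullet> \<phi> i"
    "e \<in> E \<Longrightarrow> sq_diff (\<psi> g i) e = sq_diff (\<phi> i) (g ` e)" if "g \<in> G" for g i e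
    using permute_vertices[OF G(2)[OF that], where \<phi> = "\<phi> i"] E by (simp_all add: \<psi>_def)
  have eq: "(\<Sum>g\<in>G. \<Sum>i<r. dirichlet E u (\<psi> g i)) = c * (\<Sum>e\<in>E. u e)" for u
  proof -
    have "(\<Sum>g\<in>G. \<Sum>i<r. dirichlet E u (\<psi> g i)) =
        (\<Sum>g\<in>G. \<Sum>i<r. \<Sum>e\<in>E. u e * sq_diff (\<phi> i) (g ` e))"
      by (simp add: dirichlet_def perm(3))
    also have "\<dots> = (\<Sum>g\<in>G. \<Sum>e\<in>E. \<Sum>i<r. u e * sq_diff (\<phi> i) (g ` e))"
      by (intro sum.cong refl sum.swap)
    also have "\<dots> = (\<Sum>e\<in>E. \<Sum>g\<in>G. \<Sum>i<r. u e * sq_diff (\<phi> i) (g ` e))"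
      by (rule sum.swap)
    also have "\<dots> = (\<Sum>e\<in>E. u e * c)"
      by (simp add: iso flip: sum_distrib_left)
    finally show ?thesis by (simp add: sum_distrib_left mult.commute)
  qed
  have "dirichlet E (\<lambda>_. 1) (\<psi> g i) = \<mu> * (\<phi> i \<bullet> \<phi> i)" if "g \<in> G" "i < r" for g i
  proof -
    have "inj_on (image g) E"
      using bij_is_inj[OF G(2)[OF that(1)]] by (simp add: inj_on_def inj_image_eq_iff)
    then have "bij_betw (image g) E E" using total[OF that(1)] by (simp add: bij_betw_def)
    then have "dirichlet E (\<lambda>_. 1) (\<psi> g i) = dirichlet E (\<lambda>_. 1) (\<phi> i)"
      using perm(3)[OF that(1)] sum.reindex_bij_betw[of "image g" E E "sq_diff (\<phi> i)"]
      by (simp add: dirichlet_def)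
    then show ?thesis
      using \<phi>[OF that(2)] by (simp add: laplacian_form[OF E, symmetric] eigenspace_def)
  qed
  then have "c * real (card E) = \<mu> * N"
    using eq[of "\<lambda>_. 1"] by (simp add: N_def sum_distrib_left mult.left_commute)
  moreover have "card E > 0" using ne by (simp add: card_gt_0_iff)
  then have "c * real (card E) > 0" using \<open>c > 0\<close> by simp
  ultimately have N: "c * real (card E) = \<mu> * N" "N > 0"
    using \<open>\<mu> > 0\<close> by (simp_all add: zero_less_mult_iff)
  have "s * \<nu> * (\<phi> i \<bullet> \<phi> i) \<le> s * dirichlet E w (\<psi> g i)" if "g \<in> G" "i < r" for g i
    using ext perm(1,2)[OF that(1), of i] eigenvector_orthogonal_one[OF E \<phi>[OF that(2)]] \<open>\<mu> > 0\<close>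
    by (auto simp: extremal_eigenvalue_def dest: spec[of _ "\<psi> g i"])
  then have "(\<Sum>g\<in>G. \<Sum>i<r. s * \<nu> * (\<phi> i \<bullet> \<phi> i)) \<le> (\<Sum>g\<in>G. \<Sum>i<r. s * dirichlet E w (\<psi> g i))"
    by (intro sum_mono) auto
  also have "\<dots> = s * (c * (\<Sum>e\<in>E. w e))"
    by (simp add: eq flip: sum_distrib_left)
  also have "\<dots> = s * \<mu> * N" using w N(1) by (simp add: normalized_weight_def)
  also have "(\<Sum>g\<in>G. \<Sum>i<r. s * \<nu> * (\<phi> i \<bullet> \<phi> i)) = s * \<nu> * N"
    by (simp add: N_def mult.left_commute flip: sum_distrib_left)
  finally show ?thesis using N(2) by (rule mult_right_le_imp_le)
qed

section \<open>The characterization of rigidity\<close>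

lemma embedded_edge_length:
  assumes "simple_graph E" "e \<in> E" "\<And>i v. i < r \<Longrightarrow> p v i = \<phi> i $ v"
  shows "on_edge (\<lambda>u v. (L2_set (\<lambda>i. p u i - p v i) {..<r})\<^sup>2) e = (\<Sum>i<r. sq_diff (\<phi> i) e)"
proof -
  obtain a b where e: "e = {a, b}" using edgeE assms(1,2) by blast
  have "(L2_set (\<lambda>i. p u i - p v i) {..<r})\<^sup>2 = (\<Sum>i<r. (\<phi> i $ u - \<phi> i $ v)\<^sup>2)" for u v
    using assms(3) by (simp add: L2_set_def sum_nonneg)
  then show ?thesis
    by (simp add: e sq_diff_pair on_edge_eq power2_commute)
qed

text \<open>
  In one direction an embedding with all edge lengths equal has equal orbit averages for any group;
  in the other, orbit averages are turned into group averages.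
\<close>

lemma rigid_iff_orbit_isometric:
  fixes E :: "'v::finite set set"
  assumes E: "simple_graph E" and conn: "connected_graph E" and n: "CARD('v) \<ge> 2"
    and \<Psi>: "subgroup \<Psi> (aut_group E)" and "s \<noteq> 0"
    and ext: "\<And>w. normalized_weight E w \<Longrightarrow> extremal_eigenvalue s E w (\<Lambda> w)"
  shows "(\<forall>w. normalized_weight E w \<longrightarrow> s * \<Lambda> w \<le> s * \<Lambda> (\<lambda>_. 1)) \<longleftrightarrow>
         (\<exists>r p. spectral_embedding E (\<Lambda> (\<lambda>_. 1)) r p \<and> orbit_isometric E \<Psi> r p)"
    (is "?rigid \<longleftrightarrow> ?isometric")
proof -
  define \<mu> where "\<mu> = \<Lambda> (\<lambda>_. 1)"
  have ext1: "extremal_eigenvalue s E (\<lambda>_. 1) \<mu>"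
    unfolding \<mu>_def by (rule ext) (simp add: normalized_weight_def)
  have pos: "\<mu> > 0" by (rule extremal_eigenvalue_pos[OF E conn ext1])
  have ne: "E \<noteq> {}"
  proof
    assume "E = {}"
    then have "u = v" for u v :: 'v using conn by (simp add: connected_graph_def)
    then have "CARD('v) \<le> Suc 0" unfolding card_le_Suc0_iff_eq[OF finite] by blast
    then show False using n by simp
  qed
  have orbit_edges: "Orb \<subseteq> E" "Orb \<noteq> {}" if "Orb \<in> edge_orbits E \<Psi>" for Orb
    using that automorphism_edge[OF \<Psi> E] automorphism_nonempty[OF \<Psi>]
    by (auto simp: edge_orbits_eq[OF \<Psi>])
  show ?thesis
  proof
    assume ?rigid
    then have rigid: "s * \<Lambda> w \<le> s * \<Lambda> (\<lambda>_. 1)" if "normalized_weight E w" for w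
      using that by blast
    obtain r :: nat and \<phi> where \<phi>: "\<And>i. i < r \<Longrightarrow> \<phi> i \<in> eigenspace (laplacian E (\<lambda>_. 1)) \<mu>"
      "\<And>e. e \<in> E \<Longrightarrow> (\<Sum>i<r. sq_diff (\<phi> i) e) = \<mu> / card E"
      using rigid_imp_edge_isometric[where \<Lambda> = \<Lambda>, OF E ne \<open>s \<noteq> 0\<close> ext rigid, folded \<mu>_def]
      by blast
    define p where "p = (\<lambda>v i. \<phi> i $ v)"
    have "is_eigenvalue (laplacian E (\<lambda>_. 1)) \<mu>"
      using ext1 unfolding extremal_eigenvalue_def is_eigenvalue_def
      by (metis norm_zero zero_neq_one)
    then have "spectral_embedding E \<mu> r p"
      using pos \<phi>(1) by (auto simp: spectral_embedding_def p_def)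
    moreover have "orbit_isometric E \<Psi> r p"
      unfolding orbit_isometric_def
    proof (intro exI[of _ "\<mu> / card E"] conjI ballI)
      show "\<mu> / card E > 0" using pos ne by (simp add: card_gt_0_iff)
      fix Orb assume Orb: "Orb \<in> edge_orbits E \<Psi>"
      have "on_edge (\<lambda>u v. (L2_set (\<lambda>i. p u i - p v i) {..<r})\<^sup>2) e = \<mu> / card E"
        if "e \<in> Orb" for e
        using that orbit_edges(1)[OF Orb] \<phi>(2)[of e] embedded_edge_length[OF E, of e r p \<phi>]
        by (auto simp: p_def)
      then show "1 / real (card Orb) *
          (\<Sum>e\<in>Orb. on_edge (\<lambda>u v. (L2_set (\<lambda>i. p u i - p v i) {..<r})\<^sup>2) e) = \<mu> / card E"
        using orbit_edges(2)[OF Orb] by simp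
    qed
    ultimately show ?isometric unfolding \<mu>_def by blast
  next
    assume ?isometric
    then obtain r :: nat and p where "spectral_embedding E \<mu> r p" and iso: "orbit_isometric E \<Psi> r p"
      unfolding \<mu>_def by blast
    then obtain \<phi> where \<phi>: "\<And>i. i < r \<Longrightarrow> \<phi> i \<in> eigenspace (laplacian E (\<lambda>_. 1)) \<mu>"
      "\<And>i v. i < r \<Longrightarrow> p v i = \<phi> i $ v"
      unfolding spectral_embedding_def by blast
    define D where "D = (\<lambda>e. \<Sum>i<r. sq_diff (\<phi> i) e)"
    obtain c where c: "c > 0" "\<And>Orb. Orb \<in> edge_orbits E \<Psi> \<Longrightarrow> (\<Sum>e\<in>Orb. D e) = real (card Orb) * c"
    proof -
      obtain c where c: "c > 0" "\<And>Orb. Orb \<in> edge_orbits E \<Psi> \<Longrightarrow> 1 / real (card Orb) *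
          (\<Sum>e\<in>Orb. on_edge (\<lambda>u v. (L2_set (\<lambda>i. p u i - p v i) {..<r})\<^sup>2) e) = c"
        using iso unfolding orbit_isometric_def by blast
      have "(\<Sum>e\<in>Orb. D e) = real (card Orb) * c" if Orb: "Orb \<in> edge_orbits E \<Psi>" for Orb
      proof -
        have "(\<Sum>e\<in>Orb. D e) =
            (\<Sum>e\<in>Orb. on_edge (\<lambda>u v. (L2_set (\<lambda>i. p u i - p v i) {..<r})\<^sup>2) e)"
          using orbit_edges(1)[OF Orb] \<phi>(2)
          by (intro sum.cong) (auto simp: D_def embedded_edge_length[OF E])
        then show ?thesis
          using c(2)[OF Orb] orbit_edges(2)[OF Orb] by (auto simp: field_simps)
      qed
      with c(1) that show ?thesis by blast
    qed
    have avg: "(\<Sum>g\<in>\<Psi>. \<Sum>i<r. sq_diff (\<phi> i) (g ` e)) = card \<Psi> * c" if "e \<in> E" for e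
    proof -
      let ?O = "{g ` e | g. g \<in> \<Psi>}"
      have O: "?O \<in> edge_orbits E \<Psi>" using that by (auto simp: edge_orbits_eq[OF \<Psi>])
      have "real (card ?O) * (\<Sum>g\<in>\<Psi>. D (g ` e)) = card \<Psi> * (\<Sum>x\<in>?O. D x)"
        using automorphism_bij[OF \<Psi>] automorphism_comp[OF \<Psi>]
        by (intro group_average_eq_orbit_average) auto
      then have "real (card ?O) * (\<Sum>g\<in>\<Psi>. D (g ` e)) = real (card ?O) * (card \<Psi> * c)"
        unfolding c(2)[OF O] by (simp only: mult_ac)
      moreover have "card ?O > 0" using orbit_edges(2)[OF O] by (simp add: card_gt_0_iff)
      ultimately show ?thesis using automorphism_nonempty[OF \<Psi>] by (simp add: D_def)
    qed
    have total: "image g ` E = E" if "g \<in> \<Psi>" for g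
    proof (rule endo_inj_surj)
      show "inj_on (image g) E"
        using bij_is_inj[OF automorphism_bij[OF \<Psi> that]] by (simp add: inj_on_def inj_image_eq_iff)
    qed (use automorphism_edge[OF \<Psi> E that] in auto)
    have "card \<Psi> * c > 0"
      using c(1) automorphism_nonempty[OF \<Psi>] by (simp add: card_gt_0_iff)
    then show ?rigid
      using averaged_isometric_imp_rigid[OF E ne automorphism_nonempty[OF \<Psi>]
          automorphism_bij[OF \<Psi>] _ ext \<phi>(1) pos _ avg total] unfolding \<mu>_def by blast
  qed
qed

theorem theorem5p5:
  fixes E :: "'v::finite set set" and \<Psi> :: "('v \<Rightarrow> 'v) set"
  assumes "CARD('v) \<ge> 2"
    and "simple_graph E"
    and "connected_graph E"
    and "subgroup \<Psi> (aut_group E)"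
  shows "(lower_conformally_rigid E \<longleftrightarrow>
           (\<exists>r p. spectral_embedding E (lap_eigenvalue E (\<lambda>_. 1) 2) r p \<and>
                  orbit_isometric E \<Psi> r p)) \<and>
         (upper_conformally_rigid E \<longleftrightarrow>
           (\<exists>r p. spectral_embedding E (lap_eigenvalue E (\<lambda>_. 1) CARD('v)) r p \<and>
                  orbit_isometric E \<Psi> r p))"
proof -
  have "extremal_eigenvalue 1 E w (lap_eigenvalue E w 2)"
    "extremal_eigenvalue (-1) E w (lap_eigenvalue E w CARD('v))" if "normalized_weight E w" for w
    using that extremal_lap_eigenvalue_2[OF assms(1,2), of w]
      extremal_lap_eigenvalue_CARD[OF assms(1,2), of w]
    by (auto simp: normalized_weight_def)
  note rigid_iff_orbit_isometric[OF assms(2,3,1,4) _ this(1)]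
    rigid_iff_orbit_isometric[OF assms(2,3,1,4) _ this(2)]
  then show ?thesis
    by (simp add: lower_conformally_rigid_def upper_conformally_rigid_def)
qed

end
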